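(* Given a graph $G$ with general position number $gp(G)$ and maximum degree $\Delta(G)$, then $\mu(G)\ge gp(G)$ and $\mu(G)\ge \Delta(G)$.
   Context: Graphs are finite, simple, loopless, undirected and unweighted. A subset $S$ of vertices of a graph $G$ is a general position set if no triple of vertices from $S$ lies on a common geodesic (shortest path) in $G$; the general position number $gp(G)$ is the size of a largest general position set of $G$. $\Delta(G)$ is the maximum, over the vertices $v$ of $G$, of the number of edges incident to $v$. For a graph $G=(V,E)$ and a set $P\subseteq V$ of points, two points are mutually visible if there is a shortest path between them in $G$ with no further point of $P$. $P$ is a mutual-visibility set of $G$ if its points are pairwise mutually visible. The mutual-visibility number $\mu(G)$ is the size of any largest mutual-visibility set of $G$.
   Formalization: The inequality μ(G) ≥ gp(G) is stated only for connected (nonempty) graphs; it fails in general: two isolated vertices have gp = 2 but μ = 1. The inequality μ(G) ≥ Δ(G) is stated for all graphs. *)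

theory Defs
  imports "Graph_Theory.Digraph_Component"
begin

text \<open>
  A finite simple undirected graph is a digraph \<open>G\<close> with \<open>graph G\<close> (finite, symmetric, without
  loops or parallel arcs); an undirected edge between \<open>u\<close> and \<open>v\<close> is the pair of opposite arcs
  between \<open>u\<close> and \<open>v\<close>.
\<close>

definition geodesic :: "('a, 'b) pre_digraph \<Rightarrow> 'a \<Rightarrow> 'b list \<Rightarrow> 'a \<Rightarrow> bool" where
  "geodesic G u p v \<longleftrightarrow>
     pre_digraph.apath G u p v \<and> (\<forall>q. pre_digraph.apath G u q v \<longrightarrow> length p \<le> length q)"

definition general_position_set :: "('a, 'b) pre_digraph \<Rightarrow> 'a set \<Rightarrow> bool" where
  "general_position_set G S \<longleftrightarrow> S \<subseteq> verts G \<and>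
     \<not> (\<exists>T u p v. T \<subseteq> S \<and> card T = 3 \<and> geodesic G u p v \<and> T \<subseteq> set (pre_digraph.awalk_verts G u p))"

definition gp_number :: "('a, 'b) pre_digraph \<Rightarrow> nat" where
  "gp_number G = Max (card ` {S. general_position_set G S})"

definition mutually_visible :: "('a, 'b) pre_digraph \<Rightarrow> 'a set \<Rightarrow> 'a \<Rightarrow> 'a \<Rightarrow> bool" where
  "mutually_visible G P u v \<longleftrightarrow>
     (\<exists>p. geodesic G u p v \<and> set (pre_digraph.awalk_verts G u p) \<inter> P \<subseteq> {u, v})"

definition mutual_visibility_set :: "('a, 'b) pre_digraph \<Rightarrow> 'a set \<Rightarrow> bool" where
  "mutual_visibility_set G P \<longleftrightarrow> P \<subseteq> verts G \<and>
     (\<forall>u\<in>P. \<forall>v\<in>P. u \<noteq> v \<longrightarrow> mutually_visible G P u v)"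

definition mutual_visibility_number :: "('a, 'b) pre_digraph \<Rightarrow> nat" where
  "mutual_visibility_number G = Max (card ` {P. mutual_visibility_set G P})"

text \<open>
  In a symmetric digraph without loops or parallel arcs, the arcs leaving \<open>v\<close> correspond
  one-to-one to the undirected edges incident to \<open>v\<close>. The supremum (rather than \<open>Max\<close>) is the
  maximum for a nonempty finite graph and makes the maximum degree of the empty graph \<open>0\<close>.
\<close>

definition max_degree :: "('a, 'b) pre_digraph \<Rightarrow> nat" where
  "max_degree G = (SUP v\<in>verts G. out_degree G v)"

end

theory Submission
  imports Defs
begin

text \<open>Both bounds come from exhibiting mutual-visibility sets. In a connected graph every
  general position set is one: a geodesic joining two of its points cannot pass through a third
  (\<open>general_position_imp_mutual_visibility\<close>). In any graph the neighbourhood of a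
  vertex \<open>v\<close> is one: two neighbours are either adjacent or joined by a geodesic of
  length 2 through \<open>v\<close>, which is not its own neighbour
  (\<open>mutual_visibility_neighbourhood\<close>).\<close>

lemma (in wf_digraph) geodesic_exists:
  assumes "u \<rightarrow>\<^sup>* v"
  obtains p where "geodesic G u p v"
proof -
  obtain p where "apath u p v \<and> (\<forall>q. apath u q v \<longrightarrow> length p \<le> length q)"
    using assms ex_has_least_nat[of "\<lambda>p. apath u p v" _ length] unfolding reachable_apath by blast
  then show ?thesis
    using that unfolding geodesic_def by blast
qed

text \<open>A third point of \<open>S\<close> on a geodesic between \<open>u\<close> and
  \<open>v\<close> would form with its endpoints a forbidden triple, so every geodesic witnesses
  visibility. Connectedness ensures that there is one.\<close>

lemma (in wf_digraph) general_position_imp_mutual_visibility: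
  assumes conn: "strongly_connected G" and gp: "general_position_set G S"
  shows "mutual_visibility_set G S"
  unfolding mutual_visibility_set_def
proof (intro conjI ballI impI)
  show S: "S \<subseteq> verts G"
    using gp by (simp add: general_position_set_def)
  fix u v assume uv: "u \<in> S" "v \<in> S" "u \<noteq> v"
  then have "u \<rightarrow>\<^sup>* v"
    using conn S by (auto simp: strongly_connected_def)
  then obtain p where p: "geodesic G u p v"
    by (rule geodesic_exists)
  then have path: "awalk u p v"
    by (simp add: geodesic_def apath_def)
  have "x \<in> {u, v}" if "x \<in> set (awalk_verts u p)" "x \<in> S" for x
  proof (rule ccontr)
    assume "x \<notin> {u, v}"
    then have "card {u, v, x} = 3"
      using uv by auto
    moreover have "{u, v, x} \<subseteq> set (awalk_verts u p)"
      using path that hd_in_awalk_verts(1)[OF path] by auto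
    ultimately show False
      using gp p uv that unfolding general_position_set_def
      by (metis empty_subsetI insert_subset)
  qed
  then show "mutually_visible G S u v"
    using p unfolding mutually_visible_def by blast
qed

lemma (in graph) mutual_visibility_neighbourhood:
  "mutual_visibility_set G (head G ` out_arcs G v)"
  unfolding mutual_visibility_set_def
proof (intro conjI ballI impI)
  let ?N = "head G ` out_arcs G v"
  show "?N \<subseteq> verts G"
    by auto
  fix u w assume u: "u \<in> ?N" and w: "w \<in> ?N" and "u \<noteq> w"
  show "mutually_visible G ?N u w"
  proof (cases "\<exists>c \<in> arcs G. tail G c = u \<and> head G c = w")
    case True
    then obtain c where c: "c \<in> arcs G" "tail G c = u" "head G c = w"
      by blast
    have "geodesic G u [c] w"
      unfolding geodesic_def
    proof (intro conjI allI impI)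
      show "apath u [c] w"
        using c \<open>u \<noteq> w\<close> by (auto simp: apath_simps)
      show "length [c] \<le> length q" if "apath u q w" for q
        using that \<open>u \<noteq> w\<close> by (cases q) (auto simp: apath_simps)
    qed
    then show ?thesis
      using c unfolding mutually_visible_def by (intro exI[of _ "[c]"]) auto
  next
    case False
    \<comment> \<open>\<open>u\<close> is given as the head of an arc leaving \<open>v\<close>;
      symmetry supplies the reverse arc.\<close>
    obtain a where a: "a \<in> arcs G" "tail G a = u" "head G a = v"
      using u sym_arcs unfolding symmetric_conv by fastforce
    obtain b where b: "b \<in> arcs G" "tail G b = v" "head G b = w"
      using w by auto
    have "v \<notin> ?N"
      using no_loops by force
    have "geodesic G u [a, b] w"
      unfolding geodesic_def
    proof (intro conjI allI impI)
      show "apath u [a, b] w"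
        using a b \<open>u \<noteq> w\<close> no_loops[OF a(1)] no_loops[OF b(1)] by (auto simp: apath_simps)
      show "length [a, b] \<le> length q" if "apath u q w" for q
        using that \<open>u \<noteq> w\<close> False
        \<comment> \<open>This case rule splits \<open>q\<close> into length 0, length 1 and length
          at least 2. The first is excluded by \<open>u \<noteq> w\<close>, the second by
          non-adjacency.\<close>
        by (cases q rule: remdups_adj.cases) (auto simp: apath_simps Suc_le_eq)
    qed
    moreover have "set (awalk_verts u [a, b]) = {u, v, w}"
      using a b by simp
    then have "set (awalk_verts u [a, b]) \<inter> ?N \<subseteq> {u, w}"
      using \<open>v \<notin> ?N\<close> by blast
    ultimately show ?thesis
      unfolding mutually_visible_def by blast
  qed
qed

text \<open>Without parallel arcs, \<open>head G\<close> is injective on the arcs leaving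
  \<open>v\<close>, so counting neighbours is counting arcs.\<close>

lemma (in nomulti_digraph) card_head_out_arcs:
  "card (head G ` out_arcs G v) = out_degree G v"
  unfolding out_degree_def
  by (intro card_image inj_onI no_multi_arcs) (auto simp: arc_to_ends_def)

lemma (in fin_digraph) finite_mutual_visibility_sets:
  "finite {P. mutual_visibility_set G P}"
  by (rule finite_subset[of _ "Pow (verts G)"]) (auto simp: mutual_visibility_set_def)

lemma (in fin_digraph) card_le_mutual_visibility_number:
  assumes "mutual_visibility_set G P"
  shows "card P \<le> mutual_visibility_number G"
  unfolding mutual_visibility_number_def
  using assms finite_mutual_visibility_sets by (intro Max_ge) auto

text \<open>Connectedness matters: two isolated vertices are in general position but not mutually
  visible, giving 2 against 1.\<close>

lemma (in graph) gp_number_le_mutual_visibility_number: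
  assumes "Digraph_Component.connected G"
  shows "gp_number G \<le> mutual_visibility_number G"
proof -
  let ?\<S> = "{S. general_position_set G S}"
  have "strongly_connected G"
    using assms sym_arcs by (rule symmetric_connected_imp_strongly_connected[rotated])
  then have vis: "mutual_visibility_set G S" if "general_position_set G S" for S
    using that by (rule general_position_imp_mutual_visibility)
  then have "finite ?\<S>"
    by (intro finite_subset[OF _ finite_mutual_visibility_sets]) auto
  \<comment> \<open>\<open>Max\<close> is meaningful only on a nonempty finite set; the empty set
    serves as a member.\<close>
  moreover have "{} \<in> ?\<S>"
    by (auto simp: general_position_set_def)
  ultimately show ?thesis
    unfolding gp_number_def using vis card_le_mutual_visibility_number
    by (subst Max_le_iff) auto
qed

lemma (in graph) max_degree_le_mutual_visibility_number:
  "max_degree G \<le> mutual_visibility_number G"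
\<comment> \<open>\<open>cSUP_least\<close> requires a nonempty index set; over the empty one the
  supremum in the naturals is 0.\<close>
proof (cases "verts G = {}")
  case True
  then show ?thesis
    by (simp add: max_degree_def)
next
  case False
  have "out_degree G v \<le> mutual_visibility_number G" for v
    using card_le_mutual_visibility_number[OF mutual_visibility_neighbourhood[of v]]
    by (simp add: card_head_out_arcs)
  then show ?thesis
    unfolding max_degree_def using False by (intro cSUP_least)
qed

theorem lemma2p6:
  fixes G :: "('a, 'b) pre_digraph"
  assumes "graph G"
  shows "(Digraph_Component.connected G \<longrightarrow> mutual_visibility_number G \<ge> gp_number G)
    \<and> mutual_visibility_number G \<ge> max_degree G"
  using assms graph.gp_number_le_mutual_visibility_number
    graph.max_degree_le_mutual_visibility_number by blast

end
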